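(* Let $\mathbb{F}$ be $\mathbb{R}$ or $\mathbb{C}$, $\mathbf{n}=(n_1,\dots,n_N)\in\mathbb{N}^N$, and let $\mathbf{p}=(p^{(1)},\dots,p^{(N)})$ be a tuple of nonzero polynomials $p^{(k)}\in\mathcal{P}_{n_k}$. Then for any $d$ with $0\le d\le\min_kn_k$, $$\min_{\widehat{\mathbf{g}}\in\mathcal{P}_{\mathbf{n}-d},\ \widehat h\in\mathcal{P}_d}\mathrm{dist}_{nrm}(\mathbf{p},\widehat{\mathbf{g}}\cdot\widehat h)=\min_{\widehat{\mathbf{g}}\in\mathcal{P}_{\mathbf{n}-d},\ \widehat h\in\mathcal{P}_d}\mathrm{dist}_{sin}(\mathbf{p},\widehat{\mathbf{g}}\cdot\widehat h).$$
   Context: $\mathcal{P}_m$ is the space of polynomials over $\mathbb{F}$ of degree at most $m$, identified with coefficient vectors in $\mathbb{F}^{m+1}$ (with the Euclidean norm $\|\cdot\|_2$ and inner product $\langle\cdot,\cdot\rangle$); $\mathcal{P}_{\mathbf{n}-d}=\mathcal{P}_{n_1-d}\times\cdots\times\mathcal{P}_{n_N-d}$, and $\widehat{\mathbf{g}}\cdot\widehat h=(\widehat g^{(1)}\widehat h,\dots,\widehat g^{(N)}\widehat h)$. For tuples $\mathbf{p},\mathbf{q}$ with $p^{(k)},q^{(k)}\in\mathcal{P}_{n_k}$, $$\mathrm{dist}_{sin}(\mathbf{p},\mathbf{q})=\sum_{k=1}^N\sin^2\big(\angle(p^{(k)},q^{(k)})\big),\qquad \mathrm{dist}_{nrm}(\mathbf{p},\mathbf{q})=\sum_{k=1}^N\frac{\|p^{(k)}-q^{(k)}\|_2^2}{\|p^{(k)}\|_2^2},$$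 where $\sin^2(\angle(x,y))=1-\frac{|\langle x,y\rangle|^2}{\|x\|_2^2\|y\|_2^2}$ for nonzero $x,y$, and $\sin^2(\angle(x,0))=1$ by convention. *)

theory Defs
  imports Complex_Main "HOL-Computational_Algebra.Polynomial" "Jordan_Normal_Form.Matrix"
begin

text \<open>
  An \<open>N\<close>-tuple is a function on \<^typ>\<open>nat\<close> of which only the components in \<open>{1..N}\<close> matter.
  The field is \<open>\<real>\<close> or \<open>\<complex>\<close>; \<open>conjugate\<close> (hence the inner product \<open>\<bullet>c\<close>) is trivial on
  \<^typ>\<open>real\<close> and is \<^const>\<open>cnj\<close> on \<^typ>\<open>complex\<close>.
\<close>

definition polys :: "nat \<Rightarrow> 'a::zero poly set" where
  "polys m = {p. degree p \<le> m}"

definition coeff_vec :: "nat \<Rightarrow> 'a::zero poly \<Rightarrow> 'a vec" where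
  "coeff_vec m p = vec (m + 1) (coeff p)"

definition vec_norm2 :: "'a::real_normed_vector vec \<Rightarrow> real" where
  "vec_norm2 v = sqrt (\<Sum>i<dim_vec v. (norm (v $ i))\<^sup>2)"

text \<open>The squared sine is extended by \<open>1\<close> when one of the vectors is zero.\<close>

definition sin2_angle :: "'a::{conjugatable_field, real_normed_field} vec \<Rightarrow> 'a vec \<Rightarrow> real" where
  "sin2_angle x y =
     (if x = 0\<^sub>v (dim_vec x) \<or> y = 0\<^sub>v (dim_vec y) then 1
      else 1 - (norm (x \<bullet>c y))\<^sup>2 / ((vec_norm2 x)\<^sup>2 * (vec_norm2 y)\<^sup>2))"

definition dist_sin ::
  "nat \<Rightarrow> (nat \<Rightarrow> nat) \<Rightarrow> (nat \<Rightarrow> 'a::{conjugatable_field, real_normed_field} poly)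
     \<Rightarrow> (nat \<Rightarrow> 'a poly) \<Rightarrow> real" where
  "dist_sin N n p q = (\<Sum>k=1..N. sin2_angle (coeff_vec (n k) (p k)) (coeff_vec (n k) (q k)))"

definition dist_nrm ::
  "nat \<Rightarrow> (nat \<Rightarrow> nat) \<Rightarrow> (nat \<Rightarrow> 'a::real_normed_field poly) \<Rightarrow> (nat \<Rightarrow> 'a poly) \<Rightarrow> real" where
  "dist_nrm N n p q =
     (\<Sum>k=1..N. (vec_norm2 (coeff_vec (n k) (p k) - coeff_vec (n k) (q k)))\<^sup>2
                / (vec_norm2 (coeff_vec (n k) (p k)))\<^sup>2)"

definition tuple_times :: "(nat \<Rightarrow> 'a::comm_semiring_0 poly) \<Rightarrow> 'a poly \<Rightarrow> nat \<Rightarrow> 'a poly" where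
  "tuple_times g h = (\<lambda>k. g k * h)"

definition factor_pairs ::
  "nat \<Rightarrow> (nat \<Rightarrow> nat) \<Rightarrow> nat \<Rightarrow> ((nat \<Rightarrow> 'a::zero poly) \<times> 'a poly) set" where
  "factor_pairs N n d = (\<Pi> k\<in>{1..N}. polys (n k - d)) \<times> polys d"

text \<open>\<open>m\<close> is the minimum of \<open>f\<close> over \<open>S\<close>; in particular it is attained.\<close>

definition is_min_value :: "('b \<Rightarrow> real) \<Rightarrow> 'b set \<Rightarrow> real \<Rightarrow> bool" where
  "is_min_value f S m \<longleftrightarrow> (\<exists>x. is_arg_min f (\<lambda>x. x \<in> S) x \<and> f x = m)"

end

theory Submission
  imports "HOL-Analysis.Function_Topology" "HOL-Analysis.Topology_Euclidean_Space" Defs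
begin

text \<open>
  One identity governs both distances. For vectors \<open>x\<close>, \<open>y\<close> and \<open>s = \<langle>x, y\<rangle>\<close>,
  \<open>\<parallel>x - y\<parallel>\<^sup>2 \<parallel>y\<parallel>\<^sup>2 = \<parallel>x\<parallel>\<^sup>2 \<parallel>y\<parallel>\<^sup>2 - |s|\<^sup>2 + |s - \<parallel>y\<parallel>\<^sup>2|\<^sup>2\<close>.
  For nonzero vectors, dividing by \<open>\<parallel>x\<parallel>\<^sup>2 \<parallel>y\<parallel>\<^sup>2\<close> shows that the squared sine never exceeds the relative squared
  distance, and that the two agree exactly when \<open>s = \<parallel>y\<parallel>\<^sup>2\<close>, that is, when \<open>y\<close> is the orthogonal
  projection of \<open>x\<close> to the line of \<open>y\<close>. That projection is a multiple of \<open>y\<close>, and the angle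
  depends only on the line; if the projection is \<open>0\<close>, both quantities are \<open>1\<close> there. Hence \<open>dist_sin \<le> dist_nrm\<close> everywhere
  (\<open>dist_sin_le_dist_nrm\<close>), and for fixed \<open>g\<close> and \<open>h\<close> the components \<open>g k\<close> can be rescaled
  separately so that \<open>dist_nrm\<close> takes the value that \<open>dist_sin\<close> has at the original pair
  (\<open>ex_rescaling_dist_nrm_eq_dist_sin\<close>). The set of admissible pairs is closed under such
  rescalings, so a minimum of \<open>dist_sin\<close> is also a minimum of \<open>dist_nrm\<close>, with the same value.

  It remains to see that \<open>dist_sin\<close> attains its minimum (\<open>dist_sin_attains_min\<close>). A zero product
  contributes the worst possible value \<open>1\<close>, and nonzero factors can be scaled freely, so it is
  enough to minimise over factors with coefficient vectors of norm one. These form a compact set,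
  and on it no product vanishes because polynomials over a field have no zero divisors.
  Therefore \<open>dist_sin\<close>, which is discontinuous only where a product is zero, is continuous there.
\<close>

unbundle no vec_syntax
hide_const (open) Module.smult

section \<open>Conjugation\<close>

text \<open>
  The reals and the complex numbers are treated at once. That conjugation is isometric, continuous
  and fixes the reals follows from the single axiom. It is written with \<open>scaleR\<close> because
  \<open>of_real\<close> is not an operation of the classes that are being combined.
\<close>

class norm_conjugate_field = conjugatable_field + real_normed_field + heine_borel +
  assumes mult_conjugate_scaleR: "x * conjugate x = (norm x)\<^sup>2 *\<^sub>R 1"

instance real :: norm_conjugate_field
  by standard (simp add: power2_eq_square)

instance complex :: norm_conjugate_field
  by standard (simp add: complex_mult_cnj cmod_power2 scaleR_conv_of_real)

lemma mult_conjugate_self: "x * conjugate x = (of_real ((norm x)\<^sup>2) :: 'a::norm_conjugate_field)"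
  by (simp add: mult_conjugate_scaleR of_real_def)

lemma norm_conjugate [simp]: "norm (conjugate x) = norm (x :: 'a::norm_conjugate_field)"
proof (cases "x = 0")
  case False
  have "norm x * norm (conjugate x) = norm x * norm x"
    by (metis abs_norm_cancel mult_conjugate_self norm_mult norm_of_real norm_power power2_eq_square)
  then show ?thesis using False by simp
qed simp

lemma conjugate_of_real [simp]: "conjugate (of_real r) = (of_real r :: 'a::norm_conjugate_field)"
proof (cases "r = 0")
  case False
  have "of_real r * conjugate (of_real r) = (of_real r * of_real r :: 'a)"
    by (simp add: mult_conjugate_self power2_eq_square flip: of_real_mult)
  then show ?thesis using False by simp
qed simp

lemma conjugate_diff: "conjugate (x - y) = conjugate x - conjugate (y :: 'a::norm_conjugate_field)"
  by (metis conjugate_dist_add conjugate_neg diff_conv_add_uminus)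

lemma continuous_on_conjugate [continuous_intros]:
  fixes f :: "'b::topological_space \<Rightarrow> 'a::norm_conjugate_field"
  assumes "continuous_on S f"
  shows "continuous_on S (\<lambda>x. conjugate (f x))"
proof -
  have "continuous_on UNIV (conjugate :: 'a \<Rightarrow> 'a)"
    unfolding continuous_on_iff by (auto simp: dist_norm simp flip: conjugate_diff)
  then show ?thesis using assms
    by (rule continuous_on_compose2) auto
qed

section \<open>Angles and relative distances of vectors\<close>

lemma cscalar_prod_sum:
  "dim_vec y = dim_vec x \<Longrightarrow> x \<bullet>c y = (\<Sum>i<dim_vec x. x $ i * conjugate (y $ i))"
  by (simp add: scalar_prod_def atLeast0LessThan)

lemma vec_norm2_sq: "(vec_norm2 v)\<^sup>2 = (\<Sum>i<dim_vec v. (norm (v $ i))\<^sup>2)"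
  by (simp add: vec_norm2_def sum_nonneg)

lemma vec_norm2_eq_0_iff: "vec_norm2 v = 0 \<longleftrightarrow> v = 0\<^sub>v (dim_vec v)"
proof -
  have "vec_norm2 v = 0 \<longleftrightarrow> (\<Sum>i<dim_vec v. (norm (v $ i))\<^sup>2) = 0"
    by (simp add: vec_norm2_def)
  also have "\<dots> \<longleftrightarrow> v = 0\<^sub>v (dim_vec v)"
    by (subst sum_nonneg_eq_0_iff) (auto simp: vec_eq_iff)
  finally show ?thesis .
qed

lemma vec_norm2_smult: "vec_norm2 (c \<cdot>\<^sub>v v) = norm c * vec_norm2 (v :: 'a::real_normed_field vec)"
proof -
  have "(\<Sum>i<dim_vec v. (norm ((c \<cdot>\<^sub>v v) $ i))\<^sup>2) = (norm c)\<^sup>2 * (\<Sum>i<dim_vec v. (norm (v $ i))\<^sup>2)"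
    by (simp add: norm_mult power_mult_distrib sum_distrib_left)
  then show ?thesis
    by (simp add: vec_norm2_def real_sqrt_mult)
qed

lemma cscalar_prod_smult_right:
  fixes x y :: "'a::norm_conjugate_field vec"
  assumes "dim_vec y = dim_vec x"
  shows "x \<bullet>c (c \<cdot>\<^sub>v y) = conjugate c * (x \<bullet>c y)"
  using assms by (simp add: cscalar_prod_sum sum_distrib_left conjugate_dist_mul mult_ac)

text \<open>
  Writing \<open>X = \<parallel>x\<parallel>\<^sup>2\<close>, \<open>Y = \<parallel>y\<parallel>\<^sup>2\<close> and \<open>s = \<langle>x, y\<rangle>\<close>, the left side is
  \<open>(X - s - cnj s + Y) Y\<close>; the terms other than \<open>X Y\<close> complete to
  \<open>(s - Y) (cnj s - Y) - s cnj s\<close>. Multiplying by \<open>Y\<close> instead of dividing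
  by it makes the case \<open>y = 0\<close> harmless.
\<close>

lemma vec_norm2_diff_identity:
  fixes x y :: "'a::norm_conjugate_field vec"
  assumes dim: "dim_vec y = dim_vec x"
  shows "(vec_norm2 (x - y))\<^sup>2 * (vec_norm2 y)\<^sup>2 =
    (vec_norm2 x)\<^sup>2 * (vec_norm2 y)\<^sup>2 - (norm (x \<bullet>c y))\<^sup>2
      + (norm (x \<bullet>c y - of_real ((vec_norm2 y)\<^sup>2)))\<^sup>2"
proof -
  define s where "s = x \<bullet>c y"
  define X Y where "X = (vec_norm2 x)\<^sup>2" and "Y = (vec_norm2 y)\<^sup>2"
  have XY: "of_real X = (\<Sum>i<dim_vec x. x $ i * conjugate (x $ i))"
    "of_real Y = (\<Sum>i<dim_vec x. y $ i * conjugate (y $ i))"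
    using dim by (simp_all add: X_def Y_def vec_norm2_sq mult_conjugate_self)
  have "of_real ((vec_norm2 (x - y))\<^sup>2) =
      (\<Sum>i<dim_vec x. (x $ i - y $ i) * conjugate (x $ i - y $ i))"
    using dim by (simp add: vec_norm2_sq mult_conjugate_self)
  also have "\<dots> = of_real X - s - conjugate s + of_real Y"
    using dim
    by (simp add: XY s_def cscalar_prod_sum sum_conjugate conjugate_diff
        conjugate_dist_mul algebra_simps sum.distrib sum_subtractf)
  finally have D: "of_real ((vec_norm2 (x - y))\<^sup>2) = of_real X - s - conjugate s + of_real Y" .
  have "(of_real ((vec_norm2 (x - y))\<^sup>2 * Y) :: 'a) =
      (of_real X - s - conjugate s + of_real Y) * of_real Y"
    by (simp only: of_real_mult D)
  also have "\<dots> = of_real X * of_real Y - s * conjugate s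
      + (s - of_real Y) * conjugate (s - of_real Y)"
    by (simp add: conjugate_diff algebra_simps)
  also have "\<dots> = of_real (X * Y - (norm s)\<^sup>2 + (norm (s - of_real Y))\<^sup>2)"
    by (simp add: mult_conjugate_self)
  finally show ?thesis
    unfolding of_real_eq_iff s_def X_def Y_def .
qed

lemma sin2_angle_le_1: "sin2_angle x y \<le> 1"
  by (simp add: sin2_angle_def)

lemma sin2_angle_zero_right [simp]: "sin2_angle x (0\<^sub>v m) = 1"
  by (simp add: sin2_angle_def)

lemma sin2_angle_smult:
  fixes x y :: "'a::norm_conjugate_field vec"
  assumes "dim_vec y = dim_vec x" and "c \<noteq> 0"
  shows "sin2_angle x (c \<cdot>\<^sub>v y) = sin2_angle x y"
proof -
  have "c \<cdot>\<^sub>v y = 0\<^sub>v (dim_vec y) \<longleftrightarrow> y = 0\<^sub>v (dim_vec y)"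
    using \<open>c \<noteq> 0\<close> by (auto simp: vec_eq_iff)
  then show ?thesis
    using assms by (simp add: sin2_angle_def cscalar_prod_smult_right vec_norm2_smult norm_mult
        power_mult_distrib)
qed

text \<open>The last square in \<open>vec_norm2_diff_identity\<close> is nonnegative.\<close>

lemma sin2_angle_le_relative_dist:
  fixes x y :: "'a::norm_conjugate_field vec"
  assumes dim: "dim_vec y = dim_vec x" and x: "x \<noteq> 0\<^sub>v (dim_vec x)"
  shows "sin2_angle x y \<le> (vec_norm2 (x - y))\<^sup>2 / (vec_norm2 x)\<^sup>2"
proof (cases "y = 0\<^sub>v (dim_vec y)")
  case True
  then have "x - y = x" using dim by (metis carrier_vec_dim_vec minus_zero_vec right_zero_vec)
  then show ?thesis using x sin2_angle_le_1 by (simp add: vec_norm2_eq_0_iff)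
next
  case False
  have pos: "(vec_norm2 x)\<^sup>2 > 0" "(vec_norm2 y)\<^sup>2 > 0"
    using x False by (simp_all add: vec_norm2_eq_0_iff)
  have "(vec_norm2 x)\<^sup>2 * (vec_norm2 y)\<^sup>2 - (norm (x \<bullet>c y))\<^sup>2 \<le> (vec_norm2 (x - y))\<^sup>2 * (vec_norm2 y)\<^sup>2"
    using vec_norm2_diff_identity[OF dim] by simp
  then have "((vec_norm2 x)\<^sup>2 * (vec_norm2 y)\<^sup>2 - (norm (x \<bullet>c y))\<^sup>2) / ((vec_norm2 x)\<^sup>2 * (vec_norm2 y)\<^sup>2)
      \<le> (vec_norm2 (x - y))\<^sup>2 * (vec_norm2 y)\<^sup>2 / ((vec_norm2 x)\<^sup>2 * (vec_norm2 y)\<^sup>2)"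
    by (intro divide_right_mono) simp_all
  then show ?thesis
    using x False pos by (simp add: sin2_angle_def diff_divide_distrib)
qed

text \<open>
  The right multiple of \<open>y\<close> is the orthogonal projection of \<open>x\<close>, for which the last square in
  \<open>vec_norm2_diff_identity\<close> vanishes. If \<open>x\<close> is orthogonal to \<open>y\<close>, or \<open>y = 0\<close>, the projection
  is \<open>0\<close> and both quantities are \<open>1\<close>; this is where the convention for the angle with the zero
  vector matters.
\<close>

lemma sin2_angle_eq_relative_dist:
  fixes x y :: "'a::norm_conjugate_field vec"
  assumes dim: "dim_vec y = dim_vec x" and x: "x \<noteq> 0\<^sub>v (dim_vec x)"
  shows "\<exists>c. (vec_norm2 (x - c \<cdot>\<^sub>v y))\<^sup>2 / (vec_norm2 x)\<^sup>2 = sin2_angle x y"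
proof (cases "x \<bullet>c y = 0 \<or> y = 0\<^sub>v (dim_vec y)")
  case True
  have "x - 0 \<cdot>\<^sub>v y = x" using dim by (auto simp: vec_eq_iff)
  moreover have "sin2_angle x y = 1"
    using True by (auto simp: sin2_angle_def)
  ultimately show ?thesis
    using x by (intro exI[of _ 0]) (simp add: vec_norm2_eq_0_iff)
next
  case False
  define c where "c = (x \<bullet>c y) / of_real ((vec_norm2 y)\<^sup>2)"
  define z where "z = c \<cdot>\<^sub>v y"
  have Y: "vec_norm2 y \<noteq> 0" and X: "vec_norm2 x \<noteq> 0" 
    using False x by (simp_all add: vec_norm2_eq_0_iff)
  then have c: "c \<noteq> 0" and s: "x \<bullet>c y = c * of_real ((vec_norm2 y)\<^sup>2)"
    using False by (simp_all add: c_def)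
  have dimz: "dim_vec z = dim_vec x" using dim by (simp add: z_def)
  have Z: "vec_norm2 z \<noteq> 0" using c Y by (simp add: z_def vec_norm2_smult)
  have "x \<bullet>c z = c * conjugate c * of_real ((vec_norm2 y)\<^sup>2)"
    unfolding z_def cscalar_prod_smult_right[OF dim] s by simp
  also have "\<dots> = of_real ((vec_norm2 z)\<^sup>2)"
    by (simp add: mult_conjugate_self z_def vec_norm2_smult power_mult_distrib)
  finally have "(vec_norm2 (x - z))\<^sup>2 * (vec_norm2 z)\<^sup>2 =
      (vec_norm2 x)\<^sup>2 * (vec_norm2 z)\<^sup>2 - (norm (x \<bullet>c z))\<^sup>2"
    using vec_norm2_diff_identity[OF dimz] by simp
  moreover have "z \<noteq> 0\<^sub>v (dim_vec z)" using Z by (simp add: vec_norm2_eq_0_iff)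
  ultimately have "(vec_norm2 (x - z))\<^sup>2 / (vec_norm2 x)\<^sup>2 = sin2_angle x z"
    using x X Z by (simp add: sin2_angle_def field_simps)
  then show ?thesis
    using sin2_angle_smult[OF dim c] by (auto simp: z_def)
qed

section \<open>Polynomials with normalised coefficients\<close>

lemma dim_coeff_vec [simp]: "dim_vec (coeff_vec m p) = m + 1"
  by (simp add: coeff_vec_def)

lemma coeff_vec_smult: "coeff_vec m (smult c p) = c \<cdot>\<^sub>v coeff_vec m p"
  by (auto simp: coeff_vec_def vec_eq_iff)

lemma coeff_vec_0 [simp]: "coeff_vec m 0 = 0\<^sub>v (m + 1)"
  by (auto simp: coeff_vec_def vec_eq_iff)

lemma coeff_vec_eq_0_iff: "p \<in> polys m \<Longrightarrow> coeff_vec m p = 0\<^sub>v (m + 1) \<longleftrightarrow> p = 0"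
  by (auto simp: coeff_vec_def vec_eq_iff polys_def)
    (metis leading_coeff_0_iff less_Suc_eq_le)

lemma vec_norm2_coeff_vec_sq: "(vec_norm2 (coeff_vec m p))\<^sup>2 = (\<Sum>i\<le>m. (norm (coeff p i))\<^sup>2)"
  by (simp add: vec_norm2_sq coeff_vec_def lessThan_Suc_atMost)

lemma mult_in_polys:
  "d \<le> m \<Longrightarrow> g \<in> polys (m - d) \<Longrightarrow> h \<in> polys d \<Longrightarrow> g * h \<in> polys m"
  unfolding polys_def using degree_mult_le[of g h] by simp

definition unit_polys :: "nat \<Rightarrow> 'a::real_normed_field poly set" where
  "unit_polys m = {u \<in> polys m. vec_norm2 (coeff_vec m u) = 1}"

lemma unit_polys_nonzero: "u \<in> unit_polys m \<Longrightarrow> u \<noteq> 0"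
  by (auto simp: unit_polys_def vec_norm2_def)

text \<open>
  The zero polynomial has no unit multiple; any unit polynomial may then replace it, since a zero
  factor already gives the largest possible angle.
\<close>

lemma ex_unit_multiple:
  fixes g :: "'a::real_normed_field poly"
  assumes "g \<in> polys m"
  shows "\<exists>u\<in>unit_polys m. g = 0 \<or> (\<exists>c. c \<noteq> 0 \<and> u = smult c g)"
proof -
  have unit: "smult (of_real (1 / vec_norm2 (coeff_vec m q))) q \<in> unit_polys m \<and>
      of_real (1 / vec_norm2 (coeff_vec m q)) \<noteq> (0::'a)"
    if "q \<in> polys m" "q \<noteq> 0" for q :: "'a poly"
  proof -
    have "vec_norm2 (coeff_vec m q) \<noteq> 0"
      using that by (simp add: vec_norm2_eq_0_iff coeff_vec_eq_0_iff[simplified])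
    moreover have "vec_norm2 (coeff_vec m q) \<ge> 0"
      by (simp add: vec_norm2_def sum_nonneg)
    ultimately show ?thesis using that
      by (auto simp: unit_polys_def coeff_vec_smult vec_norm2_smult norm_divide polys_def)
  qed
  show ?thesis
  proof (cases "g = 0")
    case True
    have "1 \<in> polys m" by (simp add: polys_def)
    with unit[of 1] True show ?thesis by auto
  next
    case False
    then show ?thesis using unit[OF assms] by blast
  qed
qed

text \<open>
  Compactness is stated for coefficient sequences in the product topology. There the unit sphere
  is a closed subset of the product of the unit balls of the field, which is compact by Tychonoff.
  In this form tuples of polynomials need no further work: they are again points of a product.
\<close>

lemma compact_coeff_unit_polys:
  "compact (coeff ` (unit_polys m :: 'a::{real_normed_field,heine_borel} poly set))"
proof -
  define B where "B = (PiE UNIV (\<lambda>_. cball 0 1) :: (nat \<Rightarrow> 'a) set)"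
  define C where "C = {a :: nat \<Rightarrow> 'a. (\<forall>i. i > m \<longrightarrow> a i = 0) \<and> (\<Sum>i\<le>m. (norm (a i))\<^sup>2) = 1}"
  have eq: "coeff ` (unit_polys m :: 'a poly set) = C"
  proof (intro Set.set_eqI iffI)
    fix a assume "a \<in> coeff ` (unit_polys m :: 'a poly set)"
    then obtain u :: "'a poly" where u: "u \<in> unit_polys m" and a: "a = coeff u" by blast
    have "(\<Sum>i\<le>m. (norm (a i))\<^sup>2) = 1"
      using u vec_norm2_coeff_vec_sq[of m u] by (simp add: unit_polys_def a)
    moreover have "\<forall>i. i > m \<longrightarrow> a i = 0"
      using u by (auto simp: unit_polys_def polys_def a intro: coeff_eq_0)
    ultimately show "a \<in> C" by (simp add: C_def)
  next
    fix a assume a: "a \<in> C"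
    then have vanish: "\<And>i. i > m \<Longrightarrow> a i = 0" by (simp add: C_def)
    then have coeff: "coeff (Abs_poly a) = a" by (rule coeff_Abs_poly)
    have "degree (Abs_poly a) \<le> m"
      by (rule degree_le) (simp add: coeff vanish)
    moreover have "(vec_norm2 (coeff_vec m (Abs_poly a)))\<^sup>2 = 1"
      using a by (simp add: vec_norm2_coeff_vec_sq coeff C_def)
    moreover have "vec_norm2 (coeff_vec m (Abs_poly a)) \<ge> 0"
      by (simp add: vec_norm2_def sum_nonneg)
    ultimately have "Abs_poly a \<in> unit_polys m"
      by (simp add: unit_polys_def polys_def power2_eq_1_iff)
    then show "a \<in> coeff ` unit_polys m" using coeff by (metis imageI)
  qed
  have "compact B"
    unfolding B_def using compactin_PiE[of "\<lambda>_. euclidean" UNIV "\<lambda>_::nat. cball (0::'a) 1"]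
    by (simp add: euclidean_product_topology)
  moreover have "closed C"
  proof -
    have "C = {a. \<forall>i. i > m \<longrightarrow> a i = 0} \<inter> {a. (\<Sum>i\<le>m. (norm (a i))\<^sup>2) = 1}"
      by (auto simp: C_def)
    also have "closed \<dots>"
      by (intro closed_Int closed_Collect_all closed_Collect_imp closed_Collect_eq open_Collect_const
          continuous_intros continuous_on_product_coordinates)
    finally show ?thesis .
  qed
  moreover have "C \<subseteq> B"
  proof
    fix a assume a: "a \<in> C"
    have "norm (a i) \<le> 1" for i
    proof (cases "i \<le> m")
      case True
      then have "(norm (a i))\<^sup>2 \<le> (\<Sum>i\<le>m. (norm (a i))\<^sup>2)"
        by (intro member_le_sum) auto
      then show ?thesis using a by (simp add: C_def abs_square_le_1)
    qed (use a in \<open>auto simp: C_def\<close>)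
    then show "a \<in> B" by (simp add: B_def PiE_UNIV_domain)
  qed
  ultimately show ?thesis
    unfolding eq by (metis compact_Int_closed inf.absorb_iff2)
qed

text \<open>
  Away from zero products the angle is a quotient of polynomial expressions in the coefficients and
  their conjugates, which makes its continuity visible.
\<close>

lemma sin2_angle_coeff_vec:
  fixes p q :: "'a::norm_conjugate_field poly"
  assumes "p \<in> polys m" "p \<noteq> 0" "q \<in> polys m" "q \<noteq> 0"
  shows "sin2_angle (coeff_vec m p) (coeff_vec m q) =
    1 - (norm (\<Sum>i\<le>m. coeff p i * conjugate (coeff q i)))\<^sup>2
        / ((\<Sum>i\<le>m. (norm (coeff p i))\<^sup>2) * (\<Sum>i\<le>m. (norm (coeff q i))\<^sup>2))"
proof -
  have "coeff_vec m p \<bullet>c coeff_vec m q = (\<Sum>i\<le>m. coeff p i * conjugate (coeff q i))"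
    by (simp add: cscalar_prod_sum coeff_vec_def lessThan_Suc_atMost)
  then show ?thesis
    using assms coeff_vec_eq_0_iff[of p m] coeff_vec_eq_0_iff[of q m]
    by (simp add: sin2_angle_def vec_norm2_coeff_vec_sq)
qed

section \<open>Attainment of the minimal angle\<close>

text \<open>
  The distance is read as a function of the coefficients of \<open>g\<close> and \<open>h\<close> and minimised over a
  product of unit spheres. Its denominators do not vanish there, because a product of nonzero
  polynomials is nonzero. Normalising \<open>g k\<close> at every index \<open>k\<close>, not only in \<open>{1..N}\<close>, keeps
  the domain compact as a set of functions on \<^typ>\<open>nat\<close>.
\<close>

lemma dist_sin_attains_min_on_unit_polys:
  fixes p :: "nat \<Rightarrow> 'a::norm_conjugate_field poly"
  assumes d: "\<And>k. k \<in> {1..N} \<Longrightarrow> d \<le> n k"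
    and p: "\<And>k. k \<in> {1..N} \<Longrightarrow> p k \<in> polys (n k) \<and> p k \<noteq> 0"
  shows "\<exists>g h. (\<forall>k. g k \<in> unit_polys (n k - d)) \<and> h \<in> unit_polys d \<and>
    (\<forall>g' h'. (\<forall>k. g' k \<in> unit_polys (n k - d)) \<and> h' \<in> unit_polys d \<longrightarrow>
      dist_sin N n p (tuple_times g h) \<le> dist_sin N n p (tuple_times g' h'))"
proof -
  define S :: "(nat \<Rightarrow> nat \<Rightarrow> 'a) set" where
    "S = PiE UNIV (\<lambda>k. coeff ` unit_polys (n k - d))"
  define T :: "(nat \<Rightarrow> 'a) set" where "T = coeff ` unit_polys d"
  \<comment> \<open>The coefficients of \<open>g k * h\<close>, by the Cauchy product formula.\<close>
  define Q :: "(nat \<Rightarrow> nat \<Rightarrow> 'a) \<times> (nat \<Rightarrow> 'a) \<Rightarrow> nat \<Rightarrow> nat \<Rightarrow> 'a" where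
    "Q c k i = (\<Sum>j\<le>i. fst c k j * snd c (i - j))" for c k i
  define F where "F c = (\<Sum>k=1..N. 1 - (norm (\<Sum>i\<le>n k. coeff (p k) i * conjugate (Q c k i)))\<^sup>2
      / ((\<Sum>i\<le>n k. (norm (coeff (p k) i))\<^sup>2) * (\<Sum>i\<le>n k. (norm (Q c k i))\<^sup>2)))" for c
  have Q: "Q (\<lambda>k. coeff (g k), coeff h) k i = coeff (g k * h) i" for g h k i
    by (simp add: Q_def coeff_mult)
  have prod: "g k * h \<in> polys (n k)" "g k * h \<noteq> 0"
    if "k \<in> {1..N}" "\<And>k. g k \<in> unit_polys (n k - d)" "h \<in> unit_polys d"
    for g :: "nat \<Rightarrow> 'a poly" and h k
    using that mult_in_polys[OF d[OF that(1)], of "g k" h] unit_polys_nonzero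
    by (auto simp: unit_polys_def)
  have F: "F (\<lambda>k. coeff (g k), coeff h) = dist_sin N n p (tuple_times g h)"
    if "\<And>k. g k \<in> unit_polys (n k - d)" "h \<in> unit_polys d" for g h
    unfolding F_def dist_sin_def tuple_times_def Q
  proof (intro sum.cong refl sin2_angle_coeff_vec[symmetric])
    fix k assume k: "k \<in> {1..N}"
    show "p k \<in> polys (n k)" "p k \<noteq> 0" "g k * h \<in> polys (n k)" "g k * h \<noteq> 0"
      using p[OF k] prod[OF k that] by simp_all
  qed
  have ex_gh: "\<exists>g h. (\<forall>k. g k \<in> unit_polys (n k - d)) \<and> h \<in> unit_polys d \<and>
      c = (\<lambda>k. coeff (g k), coeff h)" if c: "c \<in> S \<times> T" for c
  proof -
    obtain a b where ab: "c = (a, b)" by fastforce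
    have "\<forall>k. \<exists>u. u \<in> unit_polys (n k - d) \<and> a k = coeff u"
      using c unfolding ab PiE_UNIV_domain S_def by blast
    then obtain g where "\<forall>k. g k \<in> unit_polys (n k - d) \<and> a k = coeff (g k)" by metis
    moreover obtain h where "h \<in> unit_polys d" "b = coeff h"
      using c unfolding ab T_def by blast
    ultimately show ?thesis unfolding ab by (intro exI[of _ g] exI[of _ h]) auto
  qed
  have "compact (S \<times> T)"
    using compactin_PiE[of "\<lambda>_. euclidean" UNIV "\<lambda>k. coeff ` (unit_polys (n k - d) :: 'a poly set)"]
    by (intro compact_Times)
      (simp_all add: euclidean_product_topology S_def T_def compact_coeff_unit_polys)
  moreover have "S \<times> T \<noteq> {}"
  proof -
    have "unit_polys m \<noteq> ({} :: 'a poly set)" for m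
      using ex_unit_multiple[of 0 m] by (auto simp: polys_def)
    then show ?thesis by (simp add: PiE_eq_empty_iff S_def T_def)
  qed
  moreover have "continuous_on (S \<times> T) F"
  proof -
    have Qc: "continuous_on A (\<lambda>c. Q c k i)" for A k i
    proof -
      have "continuous_on A (\<lambda>c :: (nat \<Rightarrow> nat \<Rightarrow> 'a) \<times> (nat \<Rightarrow> 'a). fst c)"
        "continuous_on A (\<lambda>c :: (nat \<Rightarrow> nat \<Rightarrow> 'a) \<times> (nat \<Rightarrow> 'a). snd c)"
        by (intro continuous_on_fst continuous_on_snd continuous_on_id)+
      then have "continuous_on A (\<lambda>c :: (nat \<Rightarrow> nat \<Rightarrow> 'a) \<times> (nat \<Rightarrow> 'a). fst c k j)"
        "continuous_on A (\<lambda>c :: (nat \<Rightarrow> nat \<Rightarrow> 'a) \<times> (nat \<Rightarrow> 'a). snd c j)" for j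
        by (blast dest: continuous_on_product_then_coordinatewise)+
      then show ?thesis
        unfolding Q_def by (intro continuous_on_sum continuous_on_mult) auto
    qed
    have nz: "(\<Sum>i\<le>n k. (norm (coeff (p k) i))\<^sup>2) * (\<Sum>i\<le>n k. (norm (Q c k i))\<^sup>2) \<noteq> 0"
      if k: "k \<in> {1..N}" and c: "c \<in> S \<times> T" for c k
    proof -
      obtain g h where gh: "\<And>k. g k \<in> unit_polys (n k - d)" "h \<in> unit_polys d"
        and c: "c = (\<lambda>k. coeff (g k), coeff h)" using ex_gh[OF c] by blast
      have "vec_norm2 (coeff_vec (n k) q) \<noteq> 0" if "q \<in> polys (n k)" "q \<noteq> 0" for q :: "'a poly"
        using coeff_vec_eq_0_iff[OF that(1)] that(2) by (simp add: vec_norm2_eq_0_iff)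
      from this[of "p k"] this[of "g k * h"] show ?thesis
        using p[OF k] prod[OF k gh] unfolding c Q
        by (simp flip: vec_norm2_coeff_vec_sq)
    qed
    show ?thesis
      unfolding F_def by (intro continuous_intros Qc ballI nz)
  qed
  ultimately obtain c where c: "c \<in> S \<times> T" and min: "\<And>c'. c' \<in> S \<times> T \<Longrightarrow> F c \<le> F c'"
    using continuous_attains_inf[of "S \<times> T" F] by blast
  obtain g h where gh: "\<And>k. g k \<in> unit_polys (n k - d)" "h \<in> unit_polys d"
    and c_eq: "c = (\<lambda>k. coeff (g k), coeff h)" using ex_gh[OF c] by blast
  have "dist_sin N n p (tuple_times g h) \<le> dist_sin N n p (tuple_times g' h')"
    if gh': "\<And>k. g' k \<in> unit_polys (n k - d)" "h' \<in> unit_polys d" for g' h'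
    using min[of "(\<lambda>k. coeff (g' k), coeff h')"] F[OF gh] F[OF gh'] gh'
    by (auto simp: c_eq S_def T_def)
  then show ?thesis using gh by blast
qed

text \<open>
  Replacing each nonzero factor by a unit multiple keeps every nonzero product in its line, hence
  keeps its angle. Where a product is zero the angle term is \<open>1\<close>, so any replacement
  is at least as good.
\<close>

lemma dist_sin_attains_min:
  fixes p :: "nat \<Rightarrow> 'a::norm_conjugate_field poly"
  assumes d: "\<And>k. k \<in> {1..N} \<Longrightarrow> d \<le> n k"
    and p: "\<And>k. k \<in> {1..N} \<Longrightarrow> p k \<in> polys (n k) \<and> p k \<noteq> 0"
  obtains g :: "nat \<Rightarrow> 'a poly" and h where "(g, h) \<in> factor_pairs N n d"
    "\<And>g' h'. (g', h') \<in> factor_pairs N n d \<Longrightarrow>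
      dist_sin N n p (tuple_times g h) \<le> dist_sin N n p (tuple_times g' h')"
proof -
  obtain g h where gh: "\<And>k. g k \<in> unit_polys (n k - d)" "h \<in> unit_polys d"
    and min: "\<And>g' h'. (\<forall>k. g' k \<in> unit_polys (n k - d)) \<Longrightarrow> h' \<in> unit_polys d \<Longrightarrow>
      dist_sin N n p (tuple_times g h) \<le> dist_sin N n p (tuple_times g' h')"
    using dist_sin_attains_min_on_unit_polys[of N d n p, OF d p] by blast
  show thesis
  proof
    show "(g, h) \<in> factor_pairs N n d"
      using gh by (simp add: factor_pairs_def unit_polys_def)
  next
    fix g' :: "nat \<Rightarrow> 'a poly" and h' :: "'a poly" assume gh': "(g', h') \<in> factor_pairs N n d"
    then have h': "h' \<in> polys d" and g': "\<And>k. k \<in> {1..N} \<Longrightarrow> g' k \<in> polys (n k - d)"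
      by (auto simp: factor_pairs_def)
    obtain v where v: "v \<in> unit_polys d" "h' = 0 \<or> (\<exists>c. c \<noteq> 0 \<and> v = smult c h')"
      using ex_unit_multiple[OF h'] by blast
    have "\<exists>u\<in>unit_polys (n k - d).
        k \<in> {1..N} \<longrightarrow> g' k = 0 \<or> (\<exists>c. c \<noteq> 0 \<and> u = smult c (g' k))" for k
      using ex_unit_multiple[OF g'[of k]] ex_unit_multiple[of 0 "n k - d"]
      by (cases "k \<in> {1..N}") (auto simp: polys_def)
    then obtain u where u: "\<And>k. u k \<in> unit_polys (n k - d)"
      "\<And>k. k \<in> {1..N} \<Longrightarrow> g' k = 0 \<or> (\<exists>c. c \<noteq> 0 \<and> u k = smult c (g' k))"
      by metis
    have "dist_sin N n p (tuple_times u v) \<le> dist_sin N n p (tuple_times g' h')"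
      unfolding dist_sin_def tuple_times_def
    proof (rule sum_mono)
      fix k assume k: "k \<in> {1..N}"
      show "sin2_angle (coeff_vec (n k) (p k)) (coeff_vec (n k) (u k * v))
          \<le> sin2_angle (coeff_vec (n k) (p k)) (coeff_vec (n k) (g' k * h'))"
      proof (cases "g' k = 0 \<or> h' = 0")
        case True
        then show ?thesis using sin2_angle_le_1 by auto
      next
        case False
        then obtain a b where "a \<noteq> 0" "u k = smult a (g' k)" "b \<noteq> 0" "v = smult b h'"
          using u(2)[OF k] v(2) by blast
        then show ?thesis
          by (simp add: coeff_vec_smult sin2_angle_smult)
      qed
    qed
    with min[of u v] u(1) v(1)
    show "dist_sin N n p (tuple_times g h) \<le> dist_sin N n p (tuple_times g' h')"
      by fastforce
  qed
qed

section \<open>Comparison of the two distances\<close>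

lemma dist_sin_le_dist_nrm:
  fixes p :: "nat \<Rightarrow> 'a::norm_conjugate_field poly"
  assumes "\<And>k. k \<in> {1..N} \<Longrightarrow> p k \<in> polys (n k) \<and> p k \<noteq> 0"
  shows "dist_sin N n p q \<le> dist_nrm N n p q"
  unfolding dist_sin_def dist_nrm_def
  using assms by (intro sum_mono sin2_angle_le_relative_dist) (auto simp: coeff_vec_eq_0_iff[simplified])

lemma ex_rescaling_dist_nrm_eq_dist_sin:
  fixes p :: "nat \<Rightarrow> 'a::norm_conjugate_field poly"
  assumes p: "\<And>k. k \<in> {1..N} \<Longrightarrow> p k \<in> polys (n k) \<and> p k \<noteq> 0"
  shows "\<exists>c. dist_nrm N n p (\<lambda>k. smult (c k) (q k)) = dist_sin N n p q"
proof -
  have "\<exists>c. (vec_norm2 (coeff_vec (n k) (p k) - coeff_vec (n k) (smult c (q k))))\<^sup>2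
        / (vec_norm2 (coeff_vec (n k) (p k)))\<^sup>2
      = sin2_angle (coeff_vec (n k) (p k)) (coeff_vec (n k) (q k))" if "k \<in> {1..N}" for k
    using sin2_angle_eq_relative_dist[of "coeff_vec (n k) (q k)" "coeff_vec (n k) (p k)"] p[OF that]
    by (simp add: coeff_vec_smult coeff_vec_eq_0_iff[simplified])
  then obtain c where "\<And>k. k \<in> {1..N} \<Longrightarrow>
      (vec_norm2 (coeff_vec (n k) (p k) - coeff_vec (n k) (smult (c k) (q k))))\<^sup>2
        / (vec_norm2 (coeff_vec (n k) (p k)))\<^sup>2
      = sin2_angle (coeff_vec (n k) (p k)) (coeff_vec (n k) (q k))"
    by metis
  then have "dist_nrm N n p (\<lambda>k. smult (c k) (q k)) = dist_sin N n p q"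
    unfolding dist_nrm_def dist_sin_def by (intro sum.cong) auto
  then show ?thesis by blast
qed

text \<open>
  At a minimum of \<open>dist_sin\<close>, scaling each \<open>g k\<close> by the factor that projects \<open>p k\<close> to the line
  of \<open>g k * h\<close> gives an admissible pair at which \<open>dist_nrm\<close> equals that minimum. No pair does
  better, because \<open>dist_sin\<close> bounds \<open>dist_nrm\<close> from below.
\<close>

lemma common_min_value_dist_nrm_dist_sin:
  fixes p :: "nat \<Rightarrow> 'a::norm_conjugate_field poly"
  assumes d: "\<And>k. k \<in> {1..N} \<Longrightarrow> d \<le> n k"
    and p: "\<And>k. k \<in> {1..N} \<Longrightarrow> p k \<in> polys (n k) \<and> p k \<noteq> 0"
  shows "\<exists>m. is_min_value (\<lambda>(g, h). dist_nrm N n p (tuple_times g h)) (factor_pairs N n d) m \<and>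
             is_min_value (\<lambda>(g, h). dist_sin N n p (tuple_times g h)) (factor_pairs N n d) m"
proof -
  obtain g h where gh: "(g, h) \<in> factor_pairs N n d"
    and min: "\<And>g' h'. (g', h') \<in> factor_pairs N n d \<Longrightarrow>
      dist_sin N n p (tuple_times g h) \<le> dist_sin N n p (tuple_times g' h')"
    by (rule dist_sin_attains_min[of N d n p, OF d p]) blast+
  obtain c where c: "dist_nrm N n p (\<lambda>k. smult (c k) (tuple_times g h k)) =
      dist_sin N n p (tuple_times g h)"
    using ex_rescaling_dist_nrm_eq_dist_sin[of N p n, OF p] by blast
  define g' where "g' k = smult (c k) (g k)" for k
  have g': "(g', h) \<in> factor_pairs N n d"
    using gh by (auto simp: factor_pairs_def polys_def g'_def Pi_iff)
  have nrm_eq: "dist_nrm N n p (tuple_times g' h) = dist_sin N n p (tuple_times g h)"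
    using c by (simp add: g'_def tuple_times_def)
  have "is_min_value (\<lambda>(g, h). dist_sin N n p (tuple_times g h)) (factor_pairs N n d)
      (dist_sin N n p (tuple_times g h))"
    unfolding is_min_value_def is_arg_min_linorder
    by (rule exI[of _ "(g, h)"]) (use gh min in auto)
  moreover have "dist_nrm N n p (tuple_times g' h) \<le> dist_nrm N n p (tuple_times u v)"
    if "(u, v) \<in> factor_pairs N n d" for u v
    using min[OF that] dist_sin_le_dist_nrm[of N p n "tuple_times u v", OF p] nrm_eq by linarith
  then have "is_min_value (\<lambda>(g, h). dist_nrm N n p (tuple_times g h)) (factor_pairs N n d)
      (dist_sin N n p (tuple_times g h))"
    unfolding is_min_value_def is_arg_min_linorder
    by (intro exI[of _ "(g', h)"]) (use g' nrm_eq in auto)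
  ultimately show ?thesis by blast
qed

theorem proposition6p14:
  fixes N d :: nat and n :: "nat \<Rightarrow> nat"
  assumes "N \<ge> 1"
    and "d \<le> Min (n ` {1..N})"
  shows
    "(\<forall>p :: nat \<Rightarrow> real poly. (\<forall>k\<in>{1..N}. p k \<in> polys (n k) \<and> p k \<noteq> 0) \<longrightarrow>
        (\<exists>m. is_min_value (\<lambda>(g, h). dist_nrm N n p (tuple_times g h)) (factor_pairs N n d) m \<and>
             is_min_value (\<lambda>(g, h). dist_sin N n p (tuple_times g h)) (factor_pairs N n d) m)) \<and>
     (\<forall>p :: nat \<Rightarrow> complex poly. (\<forall>k\<in>{1..N}. p k \<in> polys (n k) \<and> p k \<noteq> 0) \<longrightarrow>
        (\<exists>m. is_min_value (\<lambda>(g, h). dist_nrm N n p (tuple_times g h)) (factor_pairs N n d) m \<and>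
             is_min_value (\<lambda>(g, h). dist_sin N n p (tuple_times g h)) (factor_pairs N n d) m))"
proof -
  have d: "d \<le> n k" if "k \<in> {1..N}" for k
    using assms that by (meson Min_le finite_atLeastAtMost finite_imageI imageI order_trans)
  show ?thesis
    by (intro conjI allI impI; rule common_min_value_dist_nrm_dist_sin) (auto simp: d)
qed

end
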